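(* For $\alpha,b,c\in\mathbb C$ define $$\mathcal C_{\alpha;b,c}(z):=\sum_{n\ge0}\binom{\alpha}{n}T_n(b,c)z^n,$$ where $T_n(b,c)$ is the generalized central trinomial coefficient defined in the context. Then, for all $\alpha,b,c\in\mathbb C$, $$\mathcal C_{\alpha;b,c}\!\left(-\frac{z}{1+2bz}\right)=(1+2bz)^{-\alpha}\,\mathcal C_{\alpha;b,c}(z).$$ Consequently, for every formal power series $h(z)\in\mathbb C[[z]]$ and every integer $r\ge0$, $$[z^r]\,h(z)\,\mathcal C_{\alpha;b,c}(z)=[z^r]\,h\!\left(\frac{z}{1-2bz}\right)(1-2bz)^{r-1-\alpha}\,\mathcal C_{\alpha;b,c}(-z).$$
   Context: $[z^r]H(z)$ denotes the coefficient of $z^r$ in $H(z)$. For $\beta\in\mathbb C$ and $w\in z\mathbb C[[z]]$, $(1+w)^\beta:=\sum_{k\ge0}\binom{\beta}{k}w^k$. For $b,c\in\mathbb C$, $$T_n(b,c):=[x^0]\,(b+x+cx^{-1})^n=\sum_{j=0}^{\lfloor n/2\rfloor}\binom{n}{2j}\binom{2j}{j}b^{n-2j}c^j,$$ with the convention $0^0=1$. *)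

theory Defs
  imports Complex_Main "HOL-Computational_Algebra.Computational_Algebra"
begin

text \<open>The generalized central trinomial coefficient: the constant term of the Laurent polynomial
  \<open>(b + x + c x\<^sup>-\<^sup>1)\<^sup>n\<close>, taken in the ring of formal Laurent series.\<close>

definition central_trinomial :: "complex \<Rightarrow> complex \<Rightarrow> nat \<Rightarrow> complex" where
  "central_trinomial b c n = fls_nth ((fls_const b + fls_X + fls_const c * fls_X_inv) ^ n) 0"

definition central_trinomial_series :: "complex \<Rightarrow> complex \<Rightarrow> complex \<Rightarrow> complex fps" where
  "central_trinomial_series \<alpha> b c = Abs_fps (\<lambda>n. (\<alpha> gchoose n) * central_trinomial b c n)"

text \<open>The power \<open>(1 + w)\<^sup>\<beta>\<close>, i.e. the sum of \<open>(\<beta> gchoose k) * w ^ k\<close> over all \<open>k\<close>. It is meaningful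
  only for \<open>w\<close> with zero constant term, since \<^const>\<open>fps_compose\<close> truncates the sum.\<close>

definition one_plus_cpow :: "complex fps \<Rightarrow> complex \<Rightarrow> complex fps" where
  "one_plus_cpow w \<beta> = fps_compose (fps_binomial \<beta>) w"

lemma central_trinomial_eq_sum:
  "central_trinomial b c n =
    (\<Sum>j=0..n div 2. of_nat (n choose (2 * j)) * of_nat ((2 * j) choose j) * b ^ (n - 2 * j) * c ^ j)"
proof -
  have mono: "fls_nth (of_nat m * fls_X ^ i * (fls_const c * fls_X_inv) ^ l) 0 =
      (if i = l then of_nat m * c ^ l else 0)" for m i l
  proof -
    have "of_nat m * fls_X ^ i * (fls_const c * fls_X_inv) ^ l
        = fls_const (of_nat m * c ^ l) * (fls_X_inv ^ l * fls_X ^ i)"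
      by (simp add: power_mult_distrib fls_const_power fls_of_nat
          fls_const_mult_const[symmetric] mult_ac del: fls_const_mult_const)
    then show ?thesis
      by (simp add: fls_X_inv_power_times_conv_shift(1))
  qed
  have inner: "fls_nth ((fls_X + fls_const c * fls_X_inv) ^ k) 0 =
      (if even k then of_nat (k choose (k div 2)) * c ^ (k div 2) else 0)" for k
  proof -
    have "fls_nth ((fls_X + fls_const c * fls_X_inv) ^ k) 0
        = (\<Sum>i\<le>k. if i = k - i then of_nat (k choose i) * c ^ (k - i) else 0)"
      by (simp add: binomial_ring fls_nth_sum mono)
    also have "\<dots> = (\<Sum>i\<le>k. if even k \<and> i = k div 2
        then of_nat (k choose (k div 2)) * c ^ (k div 2) else 0)"
    proof (intro sum.cong refl)
      fix i assume "i \<in> {..k}"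
      then have "i = k - i \<longleftrightarrow> even k \<and> i = k div 2"
        by (simp, presburger)
      moreover have "k - k div 2 = k div 2" if "even k"
        using that by presburger
      ultimately show "(if i = k - i then of_nat (k choose i) * c ^ (k - i) else 0)
          = (if even k \<and> i = k div 2 then of_nat (k choose (k div 2)) * c ^ (k div 2) else 0)"
        by (auto split: if_splits)
    qed
    also have "\<dots> = (if even k then of_nat (k choose (k div 2)) * c ^ (k div 2) else 0)"
      by (cases "even k") (simp_all add: sum.delta)
    finally show ?thesis .
  qed
  have reorder: "fls_const b + fls_X + fls_const c * fls_X_inv
      = (fls_X + fls_const c * fls_X_inv) + fls_const b"
    by (simp add: add_ac)
  have "central_trinomial b c n
      = fls_nth (\<Sum>k\<le>n. fls_const (of_nat (n choose k) * b ^ (n - k))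
          * (fls_X + fls_const c * fls_X_inv) ^ k) 0"
    unfolding central_trinomial_def reorder
    by (subst binomial_ring) (simp add: fls_const_power fls_of_nat
        fls_const_mult_const[symmetric] mult_ac del: fls_const_mult_const)
  also have "\<dots> = (\<Sum>k\<le>n. of_nat (n choose k) * b ^ (n - k)
      * (if even k then of_nat (k choose (k div 2)) * c ^ (k div 2) else 0))"
    by (simp add: fls_nth_sum inner)
  also have "\<dots> = (\<Sum>k\<in>(\<lambda>j. 2 * j) ` {0..n div 2}. of_nat (n choose k) * b ^ (n - k)
      * (of_nat (k choose (k div 2)) * c ^ (k div 2)))"
  proof (rule sum.mono_neutral_cong_right)
    show "\<forall>k\<in>{..n} - (\<lambda>j. 2 * j) ` {0..n div 2}. of_nat (n choose k) * b ^ (n - k)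
      * (if even k then of_nat (k choose (k div 2)) * c ^ (k div 2) else 0) = 0"
      by (auto elim!: evenE)
  qed auto
  also have "\<dots> = (\<Sum>j=0..n div 2. of_nat (n choose (2 * j)) * of_nat ((2 * j) choose j)
      * b ^ (n - 2 * j) * c ^ j)"
    by (subst sum.reindex) (auto intro!: inj_onI sum.cong)
  finally show ?thesis .
qed

end

(* Put D(x) = sum_j binom(alpha, 2j) binom(2j, j) x^j. Since binom(alpha, n) binom(n, 2j) =
   binom(alpha, 2j) binom(alpha - 2j, n - 2j), the series is C(z) = (1 + bz)^alpha D(c z^2 / (1 + bz)^2).
   Under z -> -z / (1 + 2bz) the factor 1 + bz becomes (1 + bz) / (1 + 2bz), so the argument of D is
   invariant and only (1 + 2bz)^(-alpha) is picked up. The coefficient identity follows by combining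
   this, at -z, with the Lagrange-type rule [z^r] F(z) = [z^r] F(z / (1 - 2bz)) (1 - 2bz)^(r - 1). *)

theory Submission
  imports Defs
begin

text \<open>Since \<open>y ^ i\<close> has no terms below degree \<open>i\<close>, the truncated
  sums defining the coefficients of the composition can all be extended to the common bound
  \<open>n\<close> and swapped with the convolution. Keeping the factor \<open>p\<close> inside lets
  it be merged with \<open>y ^ i\<close> before a coefficient is read off.\<close>

lemma fps_compose_mult_nth:
  fixes f y p :: "complex fps"
  assumes "fps_nth y 0 = 0"
  shows "fps_nth (fps_compose f y * p) n = (\<Sum>i\<le>n. fps_nth f i * fps_nth (y ^ i * p) n)"
proof -
  have "fps_nth (fps_compose f y) k = (\<Sum>i\<le>n. fps_nth f i * fps_nth (y ^ i) k)" if "k \<le> n" for k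
    unfolding fps_compose_nth
    by (rule sum.mono_neutral_left) (use that startsby_zero_power_prefix[OF assms] in auto)
  then have "fps_nth (fps_compose f y * p) n
      = (\<Sum>k=0..n. (\<Sum>i\<le>n. fps_nth f i * fps_nth (y ^ i) k) * fps_nth p (n - k))"
    by (simp add: fps_mult_nth)
  also have "\<dots> = (\<Sum>i\<le>n. fps_nth f i * fps_nth (y ^ i * p) n)"
    unfolding fps_mult_nth sum_distrib_left sum_distrib_right
    by (subst sum.swap) (simp add: mult_ac)
  finally show ?thesis .
qed

lemma one_plus_cpow_nth_0 [simp]: "fps_nth (one_plus_cpow w \<beta>) 0 = 1"
  by (simp add: one_plus_cpow_def)

lemma one_plus_cpow_linear_nth:
  "fps_nth (one_plus_cpow (fps_const a * fps_X) \<beta>) n = (\<beta> gchoose n) * a ^ n"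
  by (simp add: one_plus_cpow_def fps_nth_compose_linear)

lemma one_plus_cpow_add:
  assumes "fps_nth w 0 = 0"
  shows "one_plus_cpow w (\<beta> + \<gamma>) = one_plus_cpow w \<beta> * one_plus_cpow w \<gamma>"
  using assms by (simp add: one_plus_cpow_def fps_binomial_add_mult fps_compose_mult_distrib)

lemma one_plus_cpow_0 [simp]: "one_plus_cpow w 0 = 1"
  by (simp add: one_plus_cpow_def)

lemma one_plus_cpow_of_nat:
  assumes "fps_nth w 0 = 0"
  shows "one_plus_cpow w (of_nat n) = (1 + w) ^ n"
  using assms
  by (simp add: one_plus_cpow_def fps_binomial_of_nat fps_compose_add_distrib
      flip: fps_compose_power)

text \<open>Turns the divisions in the substitutions into powers, which then merge with other powers
  of the same series by adding exponents.\<close>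

lemma one_plus_cpow_minus_1:
  assumes "fps_nth w 0 = 0"
  shows "one_plus_cpow w (- 1) = inverse (1 + w)"
proof -
  have "one_plus_cpow w (- 1) * (1 + w) = 1"
    using one_plus_cpow_add[OF assms, of "- 1" 1] one_plus_cpow_of_nat[OF assms, of 1] by simp
  then show ?thesis
    by (metis fps_inverse_unique mult.commute)
qed

lemma one_plus_cpow_power:
  assumes "fps_nth w 0 = 0"
  shows "one_plus_cpow w \<beta> ^ n = one_plus_cpow w (of_nat n * \<beta>)"
  by (induction n) (simp_all add: one_plus_cpow_add[OF assms] distrib_right)

lemma one_plus_cpow_compose:
  assumes "fps_nth w 0 = 0" "fps_nth v 0 = 0"
  shows "fps_compose (one_plus_cpow w \<beta>) v = one_plus_cpow (fps_compose w v) \<beta>"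
  using assms by (simp add: one_plus_cpow_def fps_compose_assoc)

text \<open>The binomial series B satisfies (1 + X) B' = \<beta> B; composing with \<open>w\<close>
  and applying the chain rule gives this equation.\<close>

lemma fps_deriv_one_plus_cpow:
  assumes "fps_nth w 0 = 0"
  shows "(1 + w) * fps_deriv (one_plus_cpow w \<beta>) = fps_const \<beta> * fps_deriv w * one_plus_cpow w \<beta>"
proof -
  have "fps_deriv (fps_binomial \<beta>) * (1 + fps_X) = fps_const \<beta> * fps_binomial \<beta>"
    by (subst fps_binomial_deriv) (simp add: fps_divide_unit mult.assoc inverse_mult_eq_1)
  then have "fps_compose (fps_deriv (fps_binomial \<beta>) * (1 + fps_X)) w
      = fps_compose (fps_const \<beta> * fps_binomial \<beta>) w"
    by simp
  then have "fps_compose (fps_deriv (fps_binomial \<beta>)) w * (1 + w) = fps_const \<beta> * one_plus_cpow w \<beta>"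
    using assms by (simp add: fps_compose_mult_distrib fps_compose_add_distrib one_plus_cpow_def)
  then show ?thesis
    using assms by (simp add: one_plus_cpow_def fps_compose_deriv) (metis mult.assoc mult.commute)
qed

text \<open>The quotient k = f / g exists because \<open>g\<close> has nonzero constant term. Then p
  k' g = p f' - k p g' = q f - k q g = 0, so k' = 0, and comparing constant terms gives k =
  1.\<close>

lemma fps_linear_ODE_unique:
  fixes f g p q :: "complex fps"
  assumes f: "p * fps_deriv f = q * f" and g: "p * fps_deriv g = q * g"
    and "p \<noteq> 0" "fps_nth f 0 = fps_nth g 0" "fps_nth g 0 \<noteq> 0"
  shows "f = g"
proof -
  have g0: "g \<noteq> 0" using assms(5) by auto
  have gg: "g * inverse g = 1"
    using assms(5) by (simp add: inverse_mult_eq_1')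
  define k where "k = f * inverse g"
  have f_eq: "f = k * g"
    using gg by (simp add: k_def algebra_simps)
  have "p * (fps_deriv k * g) = p * fps_deriv f - k * (p * fps_deriv g)"
    by (simp add: f_eq algebra_simps)
  also have "\<dots> = 0"
    by (simp add: f g) (simp add: f_eq)
  finally have "fps_deriv k = 0"
    using \<open>p \<noteq> 0\<close> g0 by simp
  then have "k = fps_const (fps_nth k 0)"
    by simp
  moreover have "fps_nth k 0 = 1"
    using assms(4,5) by (simp add: k_def)
  ultimately show ?thesis
    using f_eq by simp
qed

text \<open>Here (1 + u)(1 + v) = 1 + (u + v + u v). For a complex exponent, both sides are
  identified as solutions of the same first-order linear equation with constant term 1.\<close>

lemma one_plus_cpow_mult:
  assumes u: "fps_nth u 0 = 0" and v: "fps_nth v 0 = 0"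
  shows "one_plus_cpow u \<beta> * one_plus_cpow v \<beta> = one_plus_cpow (u + v + u * v) \<beta>"
proof (rule fps_linear_ODE_unique)
  let ?w = "u + v + u * v"
  have w: "fps_nth ?w 0 = 0" using u v by simp
  show "(1 + ?w) * fps_deriv (one_plus_cpow ?w \<beta>)
      = fps_const \<beta> * fps_deriv ?w * one_plus_cpow ?w \<beta>"
    by (rule fps_deriv_one_plus_cpow[OF w])
  let ?U = "one_plus_cpow u \<beta>" and ?V = "one_plus_cpow v \<beta>"
  have "(1 + ?w) * fps_deriv (?U * ?V)
      = (1 + v) * ?V * ((1 + u) * fps_deriv ?U) + (1 + u) * ?U * ((1 + v) * fps_deriv ?V)"
    by (simp add: algebra_simps)
  also have "\<dots> = fps_const \<beta> * fps_deriv ?w * (?U * ?V)"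
    unfolding fps_deriv_one_plus_cpow[OF u] fps_deriv_one_plus_cpow[OF v]
    by (simp add: algebra_simps)
  finally show "(1 + ?w) * fps_deriv (?U * ?V) = fps_const \<beta> * fps_deriv ?w * (?U * ?V)" .
  have "fps_nth (1 + ?w) 0 \<noteq> fps_nth 0 0" using w by simp
  then show "1 + ?w \<noteq> 0" by metis
qed simp_all

lemma gbinomial_mult_choose:
  fixes \<alpha> :: complex
  assumes "k \<le> n"
  shows "(\<alpha> gchoose n) * of_nat (n choose k) = (\<alpha> gchoose k) * (\<alpha> - of_nat k gchoose (n - k))"
  using gbinomial_trinomial_revision[OF assms, of \<alpha>] by (simp add: binomial_gbinomial)

text \<open>This is the series D of the overview; \<open>b\<close> and \<open>c\<close> enter only
  through its argument and the prefactor.\<close>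

definition trinomial_kernel :: "complex \<Rightarrow> complex fps" where
  "trinomial_kernel \<alpha> = Abs_fps (\<lambda>j. (\<alpha> gchoose (2 * j)) * of_nat ((2 * j) choose j))"

lemma central_trinomial_series_eq:
  "central_trinomial_series \<alpha> b c =
    fps_compose (trinomial_kernel \<alpha>)
      (fps_const c * fps_X ^ 2 * one_plus_cpow (fps_const b * fps_X) (- 2))
    * one_plus_cpow (fps_const b * fps_X) \<alpha>"
    (is "_ = fps_compose _ ?y * _")
proof (rule fps_ext)
  fix n
  have y: "fps_nth ?y 0 = 0" by simp
  have w: "fps_nth (fps_const b * fps_X) 0 = 0" by simp
  \<comment> \<open>The j-th term of D contributes c^j z^(2j) (1 + bz)^(\<alpha> - 2j), whose
    coefficients are explicit.\<close>
  have y_pow: "?y ^ j * one_plus_cpow (fps_const b * fps_X) \<alpha>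
      = fps_const (c ^ j) * (fps_X ^ (2 * j) * one_plus_cpow (fps_const b * fps_X) (\<alpha> - of_nat (2 * j)))"
    for j
    using one_plus_cpow_add[OF w, of "- of_nat (2 * j)" \<alpha>]
    by (simp add: power_mult_distrib one_plus_cpow_power fps_const_power mult_ac flip: power_mult)
  have "fps_nth (fps_compose (trinomial_kernel \<alpha>) ?y * one_plus_cpow (fps_const b * fps_X) \<alpha>) n
      = (\<Sum>j\<le>n. (\<alpha> gchoose (2 * j)) * of_nat ((2 * j) choose j) *
          (c ^ j * (if n < 2 * j then 0 else (\<alpha> - of_nat (2 * j) gchoose (n - 2 * j)) * b ^ (n - 2 * j))))"
    unfolding fps_compose_mult_nth[OF y] y_pow fps_mult_left_const_nth fps_X_power_mult_nth
      one_plus_cpow_linear_nth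
    by (simp add: trinomial_kernel_def)
  \<comment> \<open>Terms with 2j > n vanish. Trinomial revision then moves the dependence on
    \<alpha> into the common factor \<open>\<alpha> gchoose n\<close>.\<close>
  also have "\<dots> = (\<Sum>j=0..n div 2. (\<alpha> gchoose (2 * j)) * (\<alpha> - of_nat (2 * j) gchoose (n - 2 * j))
          * (of_nat ((2 * j) choose j) * b ^ (n - 2 * j) * c ^ j))"
    by (rule sum.mono_neutral_cong_right) (auto simp: mult_ac)
  also have "\<dots> = (\<Sum>j=0..n div 2. (\<alpha> gchoose n) * of_nat (n choose (2 * j))
          * (of_nat ((2 * j) choose j) * b ^ (n - 2 * j) * c ^ j))"
    by (intro sum.cong refl) (subst gbinomial_mult_choose, auto)
  also have "\<dots> = fps_nth (central_trinomial_series \<alpha> b c) n"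
    by (simp add: central_trinomial_series_def central_trinomial_eq_sum sum_distrib_left mult_ac)
  finally show "fps_nth (central_trinomial_series \<alpha> b c) n
      = fps_nth (fps_compose (trinomial_kernel \<alpha>) ?y * one_plus_cpow (fps_const b * fps_X) \<alpha>) n" ..
qed

lemma central_trinomial_series_reflect:
  "fps_compose (central_trinomial_series \<alpha> b c) (- (fps_X / (1 + fps_const (2 * b) * fps_X)))
     = one_plus_cpow (fps_const (2 * b) * fps_X) (- \<alpha>) * central_trinomial_series \<alpha> b c"
proof -
  let ?a = "fps_const (2 * b) * fps_X :: complex fps" and ?b = "fps_const b * fps_X :: complex fps"
  define g where "g = - (fps_X / (1 + ?a))"
  have a: "fps_nth ?a 0 = 0" and b: "fps_nth ?b 0 = 0" by simp_all
  have g_eq: "g = - (fps_X * one_plus_cpow ?a (- 1))"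
    by (simp add: g_def one_plus_cpow_minus_1 fps_divide_unit)
  have g: "fps_nth g 0 = 0" by (simp add: g_eq)
  have bg: "fps_compose ?b g = fps_const b * g"
    using g by (simp add: fps_compose_mult_distrib)
  \<comment> \<open>The aim is (1 + bg)(1 + 2bz) = 1 + bz, written without the leading 1 in the
    shape u + v + u v of \<open>one_plus_cpow_mult\<close>.\<close>
  have "g * (1 + ?a) = - fps_X"
    by (simp add: g_def fps_divide_unit mult.assoc inverse_mult_eq_1)
  then have "fps_const b * (g * (1 + ?a)) = - ?b"
    by simp
  then have "fps_const b * g + ?a + fps_const b * g * ?a = - ?b + ?a"
    by (simp add: algebra_simps)
  also have "\<dots> = ?b"
    by (simp add: fps_eq_iff)
  finally have sum: "fps_const b * g + ?a + fps_const b * g * ?a = ?b" .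
  have base: "one_plus_cpow (fps_const b * g) \<beta> = one_plus_cpow ?b \<beta> * one_plus_cpow ?a (- \<beta>)" for \<beta>
  proof -
    have "one_plus_cpow ?b \<beta> = one_plus_cpow (fps_const b * g) \<beta> * one_plus_cpow ?a \<beta>"
      using one_plus_cpow_mult[of "fps_const b * g" ?a \<beta>] g by (simp only: sum) simp
    moreover have "one_plus_cpow ?a \<beta> * one_plus_cpow ?a (- \<beta>) = 1"
      using one_plus_cpow_add[OF a, of \<beta> "- \<beta>"] by simp
    ultimately show ?thesis
      by (simp add: mult.assoc)
  qed
  let ?y = "fps_const c * fps_X ^ 2 * one_plus_cpow ?b (- 2)"
  have inv: "one_plus_cpow ?a (- 1) ^ 2 * one_plus_cpow ?a 2 = 1"
    using one_plus_cpow_add[OF a, of "- 2" 2] by (simp add: one_plus_cpow_power)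
  \<comment> \<open>The square removes the sign of \<open>g\<close> and gives (1 + 2bz)^(-2), which
    cancels the (1 + 2bz)^2 that \<open>base\<close> produces at exponent -2. Hence the argument of
    D is fixed by \<open>g\<close>.\<close>
  have "g ^ 2 * one_plus_cpow (fps_const b * g) (- 2)
      = fps_X ^ 2 * one_plus_cpow ?b (- 2) * (one_plus_cpow ?a (- 1) ^ 2 * one_plus_cpow ?a 2)"
    unfolding base by (simp add: g_eq power_mult_distrib mult_ac)
  then have "g ^ 2 * one_plus_cpow (fps_const b * g) (- 2) = fps_X ^ 2 * one_plus_cpow ?b (- 2)"
    unfolding inv by simp
  then have y: "fps_compose ?y g = ?y"
    unfolding mult.assoc
    using g
    by (simp add: fps_compose_mult_distrib one_plus_cpow_compose bg
        fps_compose_power[symmetric, of g fps_X] del: fps_const_mult_left)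
  have "fps_compose (fps_compose (trinomial_kernel \<alpha>) ?y) g = fps_compose (trinomial_kernel \<alpha>) ?y"
    using g by (subst fps_compose_assoc[symmetric]) (simp_all add: y del: fps_const_mult_left)
  then have "fps_compose (central_trinomial_series \<alpha> b c) g
      = fps_compose (trinomial_kernel \<alpha>) ?y * one_plus_cpow (fps_const b * g) \<alpha>"
    unfolding central_trinomial_series_eq
    using g by (simp add: fps_compose_mult_distrib one_plus_cpow_compose bg)
  then show ?thesis
    unfolding central_trinomial_series_eq g_def[symmetric] base by (simp add: mult_ac)
qed

text \<open>The term f_i z^i becomes f_i z^i (1 + az)^(r-1-i), with z^r coefficient f_i binom(r-1-i,
  r-i) a^(r-i). For i < r the upper entry is a natural number one less than the lower, so this is 0;
  for i = r the lower entry is 0 and f_r remains. The exponent r - 1 is complex, so it is -1 at r =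
  0.\<close>

lemma fps_nth_change_variable:
  fixes f :: "complex fps"
  shows "fps_nth f r = fps_nth (fps_compose f (fps_X / (1 + fps_const a * fps_X))
      * one_plus_cpow (fps_const a * fps_X) (of_nat r - 1)) r"
proof -
  let ?a = "fps_const a * fps_X :: complex fps"
  have a: "fps_nth ?a 0 = 0" by simp
  have g_eq: "fps_X / (1 + ?a) = fps_X * one_plus_cpow ?a (- 1)"
    by (simp add: one_plus_cpow_minus_1 fps_divide_unit)
  have g: "fps_nth (fps_X * one_plus_cpow ?a (- 1)) 0 = 0" by simp
  have pow: "(fps_X * one_plus_cpow ?a (- 1)) ^ i * one_plus_cpow ?a (of_nat r - 1)
      = fps_X ^ i * one_plus_cpow ?a (of_nat r - 1 - of_nat i)" for i
    using one_plus_cpow_add[OF a, of "- of_nat i" "of_nat r - 1"]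
    by (simp add: power_mult_distrib one_plus_cpow_power mult.assoc algebra_simps)
  have "(of_nat r - 1 - of_nat i gchoose (r - i) :: complex) = 0" if "i < r" for i
  proof -
    from that obtain d where "r = Suc (i + d)" using less_iff_Suc_add by auto
    then show ?thesis by (simp flip: binomial_gbinomial)
  qed
  then have "(\<Sum>i\<le>r. fps_nth f i * fps_nth (fps_X ^ i * one_plus_cpow ?a (of_nat r - 1 - of_nat i)) r)
      = (\<Sum>i\<le>r. if i = r then fps_nth f i else 0)"
    by (intro sum.cong refl) (auto simp: fps_X_power_mult_nth one_plus_cpow_linear_nth)
  then show ?thesis
    unfolding g_eq fps_compose_mult_nth[OF g] pow by simp
qed

theorem proposition6p5:
  fixes \<alpha> b c :: complex
  shows
    "fps_compose (central_trinomial_series \<alpha> b c) (- (fps_X / (1 + fps_const (2 * b) * fps_X)))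
       = one_plus_cpow (fps_const (2 * b) * fps_X) (- \<alpha>) * central_trinomial_series \<alpha> b c
     \<and> (\<forall>(h :: complex fps) (r :: nat).
          fps_nth (h * central_trinomial_series \<alpha> b c) r
          = fps_nth (fps_compose h (fps_X / (1 - fps_const (2 * b) * fps_X))
                     * one_plus_cpow (- (fps_const (2 * b) * fps_X)) (of_nat r - 1 - \<alpha>)
                     * fps_compose (central_trinomial_series \<alpha> b c) (- fps_X)) r)"
proof (intro conjI allI)
  show "fps_compose (central_trinomial_series \<alpha> b c) (- (fps_X / (1 + fps_const (2 * b) * fps_X)))
       = one_plus_cpow (fps_const (2 * b) * fps_X) (- \<alpha>) * central_trinomial_series \<alpha> b c"
    by (rule central_trinomial_series_reflect)
next
  fix h :: "complex fps" and r :: nat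
  let ?C = "central_trinomial_series \<alpha> b c" and ?a = "fps_const (2 * b) * fps_X :: complex fps"
  let ?g = "fps_X / (1 - ?a) :: complex fps"
  have a: "fps_nth (- ?a) 0 = 0" by simp
  have g_eq: "?g = fps_X * one_plus_cpow (- ?a) (- 1)"
    using one_plus_cpow_minus_1[OF a] by (simp add: fps_divide_unit)
  have g: "fps_nth ?g 0 = 0"
    unfolding g_eq by simp
  have a': "fps_compose ?a (- fps_X) = - ?a"
    by (simp add: fps_compose_mult_distrib)
  \<comment> \<open>Replacing z by -z in -z / (1 + 2bz) gives z / (1 - 2bz), so the reflection
    identity at -z evaluates \<open>?C\<close> at \<open>?g\<close>.\<close>
  have "fps_compose (- (fps_X / (1 + ?a))) (- fps_X) = ?g"
  proof -
    have "- (fps_X / (1 + ?a)) = - (fps_X * one_plus_cpow ?a (- 1))"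
      by (simp add: one_plus_cpow_minus_1 fps_divide_unit)
    then show ?thesis
      unfolding g_eq
      by (simp add: fps_compose_uminus fps_compose_mult_distrib one_plus_cpow_compose a')
  qed
  then have "fps_compose ?C ?g = fps_compose (fps_compose ?C (- (fps_X / (1 + ?a)))) (- fps_X)"
    by (subst fps_compose_assoc[symmetric]) (simp_all add: fps_divide_unit)
  also have "\<dots> = one_plus_cpow (- ?a) (- \<alpha>) * fps_compose ?C (- fps_X)"
    unfolding central_trinomial_series_reflect
    by (simp add: fps_compose_mult_distrib one_plus_cpow_compose a')
  finally have C: "fps_compose ?C ?g = one_plus_cpow (- ?a) (- \<alpha>) * fps_compose ?C (- fps_X)" .
  have neg: "fps_const (- (2 * b)) * fps_X = - ?a"
    by (simp add: fps_eq_iff)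
  \<comment> \<open>The change of variable with a = -2b is applied to the whole product; the
    exponents r - 1 and -\<alpha> of 1 - 2bz then add up.\<close>
  have "fps_nth (h * ?C) r
      = fps_nth (fps_compose (h * ?C) ?g * one_plus_cpow (- ?a) (of_nat r - 1)) r"
    using fps_nth_change_variable[of "h * ?C" r "- (2 * b)"] unfolding neg by simp
  also have "fps_compose (h * ?C) ?g * one_plus_cpow (- ?a) (of_nat r - 1)
      = fps_compose h ?g * (one_plus_cpow (- ?a) (of_nat r - 1) * one_plus_cpow (- ?a) (- \<alpha>))
          * fps_compose ?C (- fps_X)"
    unfolding fps_compose_mult_distrib[OF g] C by (simp only: mult_ac)
  also have "one_plus_cpow (- ?a) (of_nat r - 1) * one_plus_cpow (- ?a) (- \<alpha>)
      = one_plus_cpow (- ?a) (of_nat r - 1 - \<alpha>)"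
    using one_plus_cpow_add[OF a, of "of_nat r - 1" "- \<alpha>"] by simp
  finally show "fps_nth (h * ?C) r
      = fps_nth (fps_compose h ?g * one_plus_cpow (- ?a) (of_nat r - 1 - \<alpha>)
                     * fps_compose ?C (- fps_X)) r" .
qed

end
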